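(* Let $\ell_1,\ell_2>0$ with $\ell_1\neq\ell_2$, let $Q\in T^*{\mathcal C}$ be a point with $H(Q)=\frac12$, and let $\tilde g=\tilde G(Q)$. Let $x(t)$ be the projection to $\mathbb{R}^2$ of the trajectory $Q(t)$ of the Hamiltonian vector field $X_H$ with $Q(0)=Q$, with Frenet frame $(T(t),N(t))$ and curvature $\kappa(t)$. Let $\xi(t)$ be the vector field along $x(t)$ obtained by projecting to $\mathbb{R}^2$ the Hamiltonian vector field $X_{\tilde G}$ at the points $Q(t)$, and write $\xi=uT+vN$. Then $$u(t)=\tilde g-\frac12\kappa^2(t),\qquad v(t)=-\dot\kappa(t).$$
   Context: ${\mathcal C}=\mathbb{R}^2\times T^2$ with coordinates $(x_1,x_2,\alpha_1,\alpha_2)$ is the configuration space of 2-linkages $x,m_1,m_2$ with $x=(x_1,x_2)$, $m_i=x-\ell_i(\cos\alpha_i,\sin\alpha_i)$. On $T^*{\mathcal C}$ use coordinates $(x_1,x_2,\alpha_1,\alpha_2,p_1,p_2,\eta_1,\eta_2)$, the last four being fiber coordinates conjugate to the first four, with the standard symplectic form; the Hamiltonian vector field $X_F$ is given by $\dot x_i=F_{p_i}$, $\dot\alpha_i=F_{\eta_i}$, $\dot p_i=-F_{x_i}$, $\dot\eta_i=-F_{\alpha_i}$. Projection to $\mathbb{R}^2$ means the map to $(x_1,x_2)$. Here $$H=\frac12\left[\left(p_1-\frac{\eta_1\sin\alpha_1}{\ell_1}-\frac{\eta_2\sin\alpha_2}{\ell_2}\right)^2+\left(p_2+\frac{\eta_1\cos\alpha_1}{\ell_1}+\frac{\eta_2\cos\alpha_2}{\ell_2}\right)^2\right],$$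 $$\tilde G=\frac{\eta_1(p_2\cos\alpha_1-p_1\sin\alpha_1)}{\ell_1\ell_2^2}+\frac{\eta_2(p_2\cos\alpha_2-p_1\sin\alpha_2)}{\ell_1^2\ell_2}+\frac{p_1^2+p_2^2+1}{2}\left(\frac1{\ell_1^2}+\frac1{\ell_2^2}\right)+\frac{(\eta_1+\eta_2)^2}{2\ell_1^2\ell_2^2}.$$ On $H=\frac12$ the curve $x(t)$ is parameterized by arc length; $T=\dot x=(\cos\gamma,\sin\gamma)$, $N=(-\sin\gamma,\cos\gamma)$, $\kappa=\dot\gamma$. *)

theory Defs
  imports "HOL-Analysis.Analysis"
begin

text \<open>
  A point of the cotangent bundle is a tuple \<open>(x, \<alpha>, p, \<eta>)\<close>. The angles \<open>\<alpha>\<close> are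
  real coordinates on the universal cover of the torus. Both Hamiltonians below are
  \<open>2\<pi>\<close>-periodic in them, and every trajectory lifts.
\<close>

type_synonym phase = "(real^2) \<times> (real^2) \<times> (real^2) \<times> (real^2)"

definition base :: "phase \<Rightarrow> real^2" where
  "base z = fst z"

definition partial :: "(phase \<Rightarrow> real) \<Rightarrow> phase \<Rightarrow> phase \<Rightarrow> real" where
  "partial F e z = deriv (\<lambda>s. F (z + s *\<^sub>R e)) 0"

definition ham_vf :: "(phase \<Rightarrow> real) \<Rightarrow> phase \<Rightarrow> phase" where
  "ham_vf F z =
     ((\<chi> i. partial F (0, 0, axis i 1, 0) z),
      (\<chi> i. partial F (0, 0, 0, axis i 1) z),
      (\<chi> i. - partial F (axis i 1, 0, 0, 0) z),
      (\<chi> i. - partial F (0, axis i 1, 0, 0) z))"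

definition integral_curve :: "(phase \<Rightarrow> phase) \<Rightarrow> real set \<Rightarrow> (real \<Rightarrow> phase) \<Rightarrow> bool" where
  "integral_curve X I Q \<longleftrightarrow> (\<forall>t\<in>I. (Q has_vector_derivative X (Q t)) (at t))"

definition H :: "real \<Rightarrow> real \<Rightarrow> phase \<Rightarrow> real" where
  "H l1 l2 = (\<lambda>(x, \<alpha>, p, \<eta>).
     ((p$1 - \<eta>$1 * sin (\<alpha>$1) / l1 - \<eta>$2 * sin (\<alpha>$2) / l2)\<^sup>2
      + (p$2 + \<eta>$1 * cos (\<alpha>$1) / l1 + \<eta>$2 * cos (\<alpha>$2) / l2)\<^sup>2) / 2)"

definition G :: "real \<Rightarrow> real \<Rightarrow> phase \<Rightarrow> real" where
  "G l1 l2 = (\<lambda>(x, \<alpha>, p, \<eta>).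
     \<eta>$1 * (p$2 * cos (\<alpha>$1) - p$1 * sin (\<alpha>$1)) / (l1 * l2\<^sup>2)
     + \<eta>$2 * (p$2 * cos (\<alpha>$2) - p$1 * sin (\<alpha>$2)) / (l1\<^sup>2 * l2)
     + ((p$1)\<^sup>2 + (p$2)\<^sup>2 + 1) / 2 * (1 / l1\<^sup>2 + 1 / l2\<^sup>2)
     + (\<eta>$1 + \<eta>$2)\<^sup>2 / (2 * l1\<^sup>2 * l2\<^sup>2))"

definition tangent :: "(real \<Rightarrow> real) \<Rightarrow> real \<Rightarrow> real^2" where
  "tangent \<gamma> t = vector [cos (\<gamma> t), sin (\<gamma> t)]"

definition normal :: "(real \<Rightarrow> real) \<Rightarrow> real \<Rightarrow> real^2" where
  "normal \<gamma> t = vector [- sin (\<gamma> t), cos (\<gamma> t)]"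

text \<open>
  A tangent angle of \<open>x\<close> is a differentiable \<open>\<gamma>\<close> with \<open>x' = (cos \<gamma>, sin \<gamma>)\<close>; in particular
  \<open>x\<close> is then parameterized by arc length. On an interval \<open>\<gamma>\<close> is unique up to a constant
  in \<open>2\<pi>\<int>\<close>, so the frame and the curvature \<open>deriv \<gamma>\<close> do not depend on its choice.
\<close>

definition tangent_angle :: "real set \<Rightarrow> (real \<Rightarrow> real^2) \<Rightarrow> (real \<Rightarrow> real) \<Rightarrow> bool" where
  "tangent_angle I x \<gamma> \<longleftrightarrow>
     (\<forall>t\<in>I. \<gamma> differentiable (at t) \<and> (x has_vector_derivative tangent \<gamma> t) (at t))"

end

theory Submission
  imports Defs
begin

text \<open>
  Along a trajectory of \<open>H\<close> the velocity of the base point is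
  \<open>V = p + \<Sum>\<^sub>i (\<eta>\<^sub>i / l\<^sub>i) (- sin \<alpha>\<^sub>i, cos \<alpha>\<^sub>i)\<close>, and \<open>H\<close> is half its squared length. The momentum \<open>p\<close>
  is constant, because \<open>H\<close> does not depend on \<open>x\<close>. The equations for \<open>\<alpha>\<^sub>i\<close> and \<open>\<eta>\<^sub>i\<close>, written in
  polar coordinates, say that \<open>\<eta>\<^sub>i (cos \<alpha>\<^sub>i, sin \<alpha>\<^sub>i)\<close> has derivative \<open>(\<eta>\<^sub>i / l\<^sub>i) V\<close>
  (\<open>bar_vector_derivative\<close>). Hence \<open>V\<close> turns without changing length, at the rate
  \<open>K = \<eta>\<^sub>1 / l\<^sub>1\<^sup>2 + \<eta>\<^sub>2 / l\<^sub>2\<^sup>2\<close>: at \<open>H = 1/2\<close> this is a unit tangent, and \<open>K\<close> is the curvature of the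
  projected curve. The equation for \<open>\<eta>\<^sub>i\<close> gives the derivative \<open>K'\<close> of \<open>K\<close> as a function on phase
  space.

  The base component of the field of \<open>G\<close> is then resolved in the frame of \<open>V\<close>, after \<open>p\<close> has been
  eliminated in favour of \<open>V\<close>. Its normal component is exactly \<open>- K'\<close>. Its tangential component
  is, up to a multiple of \<open>H\<close>, the function \<open>U = \<Sum>\<^sub>i \<eta>\<^sub>i \<langle>V, (sin \<alpha>\<^sub>i, - cos \<alpha>\<^sub>i)\<rangle> / l\<^sub>i\<^sup>3\<close>. The same
  elimination of \<open>p\<close> in \<open>G\<close> itself gives \<open>G = U + K\<^sup>2 / 2\<close> up to a function of \<open>H\<close> (\<open>G_eq\<close>). On the
  level \<open>H = 1/2\<close> the two contributions of \<open>H\<close> agree, so the tangential component is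
  \<open>G - K\<^sup>2 / 2\<close>. Finally \<open>U' = - K K'\<close>, so \<open>G\<close> is conserved and keeps its initial value \<open>g\<close>.

  What remains is to compare with the angle \<open>\<gamma>\<close>. An angle exists because an antiderivative of \<open>K\<close>,
  started at an angle of \<open>V\<close> at time 0, remains an angle of \<open>V\<close>; and any differentiable angle has
  derivative \<open>K\<close>.
\<close>

section \<open>The two Hamiltonian vector fields\<close>

definition velocity :: "real \<Rightarrow> real \<Rightarrow> phase \<Rightarrow> real^2" where
  "velocity l1 l2 = (\<lambda>(x, \<alpha>, p, \<eta>). vector
     [p$1 - \<eta>$1 * sin (\<alpha>$1) / l1 - \<eta>$2 * sin (\<alpha>$2) / l2,
      p$2 + \<eta>$1 * cos (\<alpha>$1) / l1 + \<eta>$2 * cos (\<alpha>$2) / l2])"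

definition curvature :: "real \<Rightarrow> real \<Rightarrow> phase \<Rightarrow> real" where
  "curvature l1 l2 = (\<lambda>(x, \<alpha>, p, \<eta>). \<eta>$1 / l1\<^sup>2 + \<eta>$2 / l2\<^sup>2)"

lemma partial_eqI:
  "((\<lambda>s. F (z + s *\<^sub>R e)) has_real_derivative D) (at 0) \<Longrightarrow> partial F e z = D"
  unfolding partial_def by (rule DERIV_imp_deriv)

lemma ham_vf_H:
  fixes l1 l2 :: real and x \<alpha> p \<eta> :: "real^2"
  defines "V \<equiv> velocity l1 l2 (x, \<alpha>, p, \<eta>)"
  shows "ham_vf (H l1 l2) (x, \<alpha>, p, \<eta>) =
    (V,
     vector [(V$2 * cos (\<alpha>$1) - V$1 * sin (\<alpha>$1)) / l1,
             (V$2 * cos (\<alpha>$2) - V$1 * sin (\<alpha>$2)) / l2],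
     0,
     vector [\<eta>$1 * (V$1 * cos (\<alpha>$1) + V$2 * sin (\<alpha>$1)) / l1,
             \<eta>$2 * (V$1 * cos (\<alpha>$2) + V$2 * sin (\<alpha>$2)) / l2])"
proof -
  let ?z = "(x, \<alpha>, p, \<eta>)"
  note V = V_def velocity_def
  have x: "partial (H l1 l2) (axis i 1, 0, 0, 0) ?z = 0" for i
    by (rule partial_eqI) (simp add: H_def)
  \<comment> \<open>With the lengths as inverse factors, both sides are polynomials in them.\<close>
  note l = divide_inverse[of _ l1] divide_inverse[of _ l2]
  have p1: "partial (H l1 l2) (0, 0, axis 1 1, 0) ?z = V$1"
    by (rule partial_eqI, simp add: H_def axis_def V l)
      (auto simp: power2_eq_square algebra_simps add_divide_distrib diff_divide_distrib
        intro!: derivative_eq_intros)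
  have p2: "partial (H l1 l2) (0, 0, axis 2 1, 0) ?z = V$2"
    by (rule partial_eqI, simp add: H_def axis_def V l)
      (auto simp: power2_eq_square algebra_simps add_divide_distrib diff_divide_distrib
        intro!: derivative_eq_intros)
  have \<eta>1: "partial (H l1 l2) (0, 0, 0, axis 1 1) ?z = (V$2 * cos (\<alpha>$1) - V$1 * sin (\<alpha>$1)) / l1"
    by (rule partial_eqI, simp add: H_def axis_def V l)
      (auto simp: power2_eq_square algebra_simps add_divide_distrib diff_divide_distrib
        intro!: derivative_eq_intros)
  have \<eta>2: "partial (H l1 l2) (0, 0, 0, axis 2 1) ?z = (V$2 * cos (\<alpha>$2) - V$1 * sin (\<alpha>$2)) / l2"
    by (rule partial_eqI, simp add: H_def axis_def V l)
      (auto simp: power2_eq_square algebra_simps add_divide_distrib diff_divide_distrib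
        intro!: derivative_eq_intros)
  have \<alpha>1: "partial (H l1 l2) (0, axis 1 1, 0, 0) ?z = - (\<eta>$1 * (V$1 * cos (\<alpha>$1) + V$2 * sin (\<alpha>$1)) / l1)"
    by (rule partial_eqI, simp add: H_def axis_def V l)
      (auto simp: power2_eq_square algebra_simps add_divide_distrib diff_divide_distrib
        intro!: derivative_eq_intros)
  have \<alpha>2: "partial (H l1 l2) (0, axis 2 1, 0, 0) ?z = - (\<eta>$2 * (V$1 * cos (\<alpha>$2) + V$2 * sin (\<alpha>$2)) / l2)"
    by (rule partial_eqI, simp add: H_def axis_def V l)
      (auto simp: power2_eq_square algebra_simps add_divide_distrib diff_divide_distrib
        intro!: derivative_eq_intros)
  show ?thesis
    unfolding ham_vf_def by (simp add: vec_eq_iff forall_2 x p1 p2 \<eta>1 \<eta>2 \<alpha>1 \<alpha>2)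
qed

lemma base_ham_vf_G:
  fixes x \<alpha> p \<eta> :: "real^2"
  shows "base (ham_vf (G l1 l2) (x, \<alpha>, p, \<eta>)) = vector
    [(1 / l1\<^sup>2 + 1 / l2\<^sup>2) * p$1 - \<eta>$1 * sin (\<alpha>$1) / (l1 * l2\<^sup>2) - \<eta>$2 * sin (\<alpha>$2) / (l1\<^sup>2 * l2),
     (1 / l1\<^sup>2 + 1 / l2\<^sup>2) * p$2 + \<eta>$1 * cos (\<alpha>$1) / (l1 * l2\<^sup>2) + \<eta>$2 * cos (\<alpha>$2) / (l1\<^sup>2 * l2)]"
proof -
  let ?z = "(x, \<alpha>, p, \<eta>)"
  \<comment> \<open>With the lengths as inverse factors, both sides are polynomials in them.\<close>
  note l = divide_inverse[of _ "l1\<^sup>2"] divide_inverse[of _ "l2\<^sup>2"]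
    divide_inverse[of _ "l1 * l2\<^sup>2"] divide_inverse[of _ "l1\<^sup>2 * l2"]
    divide_inverse[of _ "2 * l1\<^sup>2 * l2\<^sup>2"]
  have p1: "partial (G l1 l2) (0, 0, axis 1 1, 0) ?z =
      (1 / l1\<^sup>2 + 1 / l2\<^sup>2) * p$1 - \<eta>$1 * sin (\<alpha>$1) / (l1 * l2\<^sup>2) - \<eta>$2 * sin (\<alpha>$2) / (l1\<^sup>2 * l2)"
    by (rule partial_eqI, simp add: G_def axis_def l)
      (auto simp: algebra_simps add_divide_distrib diff_divide_distrib
        intro!: derivative_eq_intros)
  have p2: "partial (G l1 l2) (0, 0, axis 2 1, 0) ?z =
      (1 / l1\<^sup>2 + 1 / l2\<^sup>2) * p$2 + \<eta>$1 * cos (\<alpha>$1) / (l1 * l2\<^sup>2) + \<eta>$2 * cos (\<alpha>$2) / (l1\<^sup>2 * l2)"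
    by (rule partial_eqI, simp add: G_def axis_def l)
      (auto simp: algebra_simps add_divide_distrib diff_divide_distrib
        intro!: derivative_eq_intros)
  show ?thesis
    unfolding ham_vf_def base_def by (simp add: vec_eq_iff forall_2 p1 p2)
qed

section \<open>Resolving the field of G along the velocity and its normal\<close>

text \<open>
  This is the derivative of \<open>curvature\<close> in the direction of the Hamiltonian field of \<open>H\<close>,
  that is, the Poisson bracket of the two functions.
\<close>
definition curvature_rate :: "real \<Rightarrow> real \<Rightarrow> phase \<Rightarrow> real" where
  "curvature_rate l1 l2 = (\<lambda>(x, \<alpha>, p, \<eta>). let V = velocity l1 l2 (x, \<alpha>, p, \<eta>) in
     \<eta>$1 * (V$1 * cos (\<alpha>$1) + V$2 * sin (\<alpha>$1)) / l1^3 +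
     \<eta>$2 * (V$1 * cos (\<alpha>$2) + V$2 * sin (\<alpha>$2)) / l2^3)"

text \<open>
  The part of \<open>G\<close>, and of the tangential component of its field, that changes along the flow of
  \<open>H\<close> and compensates the change of the squared curvature.
\<close>
definition bending :: "real \<Rightarrow> real \<Rightarrow> phase \<Rightarrow> real" where
  "bending l1 l2 = (\<lambda>(x, \<alpha>, p, \<eta>). let V = velocity l1 l2 (x, \<alpha>, p, \<eta>) in
     \<eta>$1 * (V$1 * sin (\<alpha>$1) - V$2 * cos (\<alpha>$1)) / l1^3 +
     \<eta>$2 * (V$1 * sin (\<alpha>$2) - V$2 * cos (\<alpha>$2)) / l2^3)"

lemma H_eq: "H l1 l2 z = ((velocity l1 l2 z $ 1)\<^sup>2 + (velocity l1 l2 z $ 2)\<^sup>2) / 2"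
  by (cases z) (simp add: H_def velocity_def)

text \<open>
  The dependence of \<open>G\<close> on \<open>p\<close> is traded for dependence on the velocity. The mixed terms, which
  involve the cosine of the angle between the bars, cancel, and the remaining terms quadratic in
  \<open>\<eta>\<close> form a perfect square.
\<close>
lemma G_eq:
  "G l1 l2 z = (H l1 l2 z + 1/2) * (1 / l1\<^sup>2 + 1 / l2\<^sup>2) + bending l1 l2 z
     + (curvature l1 l2 z)\<^sup>2 / 2"
proof -
  obtain x \<alpha> p \<eta> where z: "z = (x, \<alpha>, p, \<eta>)" by (cases z)
  \<comment> \<open>With reciprocal lengths the identity is polynomial.\<close>
  define j1 j2 where "j1 = 1 / l1" and "j2 = 1 / l2"
  note j = j1_def j2_def power_one_over
  define V where "V = velocity l1 l2 z"
  have V: "V$1 = p$1 - \<eta>$1 * sin (\<alpha>$1) * j1 - \<eta>$2 * sin (\<alpha>$2) * j2"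
    "V$2 = p$2 + \<eta>$1 * cos (\<alpha>$1) * j1 + \<eta>$2 * cos (\<alpha>$2) * j2"
    by (simp_all add: V_def velocity_def z j)
  have G: "2 * G l1 l2 z = 2 * \<eta>$1 * (p$2 * cos (\<alpha>$1) - p$1 * sin (\<alpha>$1)) * j1 * j2\<^sup>2
     + 2 * \<eta>$2 * (p$2 * cos (\<alpha>$2) - p$1 * sin (\<alpha>$2)) * j1\<^sup>2 * j2
     + ((p$1)\<^sup>2 + (p$2)\<^sup>2 + 1) * (j1\<^sup>2 + j2\<^sup>2)
     + (\<eta>$1 + \<eta>$2)\<^sup>2 * j1\<^sup>2 * j2\<^sup>2"
    by (simp add: G_def z j algebra_simps add_divide_distrib diff_divide_distrib)
  have K: "curvature l1 l2 z = \<eta>$1 * j1\<^sup>2 + \<eta>$2 * j2\<^sup>2"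
    by (simp add: curvature_def z j)
  have U: "bending l1 l2 z = \<eta>$1 * (V$1 * sin (\<alpha>$1) - V$2 * cos (\<alpha>$1)) * j1^3
     + \<eta>$2 * (V$1 * sin (\<alpha>$2) - V$2 * cos (\<alpha>$2)) * j2^3"
    by (simp add: bending_def V_def z j Let_def)
  have H: "2 * H l1 l2 z = (V$1)\<^sup>2 + (V$2)\<^sup>2"
    by (simp add: H_eq V_def)
  have "(sin (\<alpha>$1))\<^sup>2 + (cos (\<alpha>$1))\<^sup>2 = 1" "(sin (\<alpha>$2))\<^sup>2 + (cos (\<alpha>$2))\<^sup>2 = 1" by simp_all
  then have "2 * G l1 l2 z = (2 * H l1 l2 z + 1) * (j1\<^sup>2 + j2\<^sup>2) + 2 * bending l1 l2 z
     + (curvature l1 l2 z)\<^sup>2"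
    unfolding G K U H V by algebra
  also have "\<dots> = 2 * ((H l1 l2 z + 1/2) * (1 / l1\<^sup>2 + 1 / l2\<^sup>2) + bending l1 l2 z
     + (curvature l1 l2 z)\<^sup>2 / 2)"
    by (simp add: j algebra_simps)
  finally show ?thesis by simp
qed

text \<open>
  Compared with \<open>G_eq\<close>, the coefficient of \<open>1 / l1\<^sup>2 + 1 / l2\<^sup>2\<close> is \<open>2 H\<close> in place of \<open>H + 1/2\<close>; these
  coincide exactly on the energy level \<open>H = 1/2\<close>.
\<close>
lemma inner_G_field_velocity:
  "base (ham_vf (G l1 l2) z) \<bullet> velocity l1 l2 z
    = 2 * H l1 l2 z * (1 / l1\<^sup>2 + 1 / l2\<^sup>2) + bending l1 l2 z"
proof -
  obtain x \<alpha> p \<eta> where z: "z = (x, \<alpha>, p, \<eta>)" by (cases z)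
  define V where "V = velocity l1 l2 z"
  have p: "p$1 = V$1 + \<eta>$1 * sin (\<alpha>$1) / l1 + \<eta>$2 * sin (\<alpha>$2) / l2"
     "p$2 = V$2 - \<eta>$1 * cos (\<alpha>$1) / l1 - \<eta>$2 * cos (\<alpha>$2) / l2"
    by (simp_all add: V_def velocity_def z)
  show ?thesis
    unfolding H_eq V_def[symmetric]
    unfolding z base_ham_vf_G bending_def prod.case Let_def V_def[unfolded z, symmetric]
    by (simp add: inner_vec_def sum_2 p algebra_simps add_divide_distrib diff_divide_distrib
        power2_eq_square power3_eq_cube)
qed

text \<open>
  The coefficients \<open>1 / (l1 * l2\<^sup>2)\<close> and \<open>1 / (l1\<^sup>2 * l2)\<close> in \<open>G\<close> cancel against the part of the
  normal component of \<open>p\<close> that is scaled by the opposite bar length, which leaves \<open>1 / l1 ^ 3\<close> and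
  \<open>1 / l2 ^ 3\<close>.
\<close>
lemma inner_G_field_normal:
  "base (ham_vf (G l1 l2) z) \<bullet> vector [- velocity l1 l2 z $ 2, velocity l1 l2 z $ 1]
    = - curvature_rate l1 l2 z"
proof -
  obtain x \<alpha> p \<eta> where z: "z = (x, \<alpha>, p, \<eta>)" by (cases z)
  define V where "V = velocity l1 l2 z"
  have p: "p$1 = V$1 + \<eta>$1 * sin (\<alpha>$1) / l1 + \<eta>$2 * sin (\<alpha>$2) / l2"
     "p$2 = V$2 - \<eta>$1 * cos (\<alpha>$1) / l1 - \<eta>$2 * cos (\<alpha>$2) / l2"
    by (simp_all add: V_def velocity_def z)
  show ?thesis
    unfolding V_def[symmetric]
    unfolding z base_ham_vf_G curvature_rate_def prod.case Let_def V_def[unfolded z, symmetric]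
    by (simp add: inner_vec_def sum_2 p algebra_simps add_divide_distrib diff_divide_distrib
        power2_eq_square power3_eq_cube)
qed

section \<open>The flow of H\<close>

text \<open>
  In polar coordinates \<open>(\<eta>, \<alpha>)\<close> on the plane, the hypotheses are the radial and the angular part of
  the vector \<open>(a, b)\<close>, scaled by \<open>\<eta> / l\<close>; passing to Cartesian coordinates removes the angle. This
  is what makes the remaining computations linear in the bar vectors.
\<close>
lemma bar_vector_derivative:
  assumes "(\<alpha> has_real_derivative (b * cos (\<alpha> t) - a * sin (\<alpha> t)) / l) (at t)"
    and "(\<eta> has_real_derivative \<eta> t * (a * cos (\<alpha> t) + b * sin (\<alpha> t)) / l) (at t)"
  shows "((\<lambda>s. \<eta> s * cos (\<alpha> s)) has_real_derivative \<eta> t * a / l) (at t)"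
    and "((\<lambda>s. \<eta> s * sin (\<alpha> s)) has_real_derivative \<eta> t * b / l) (at t)"
proof -
  have sc: "(sin (\<alpha> t))\<^sup>2 + (cos (\<alpha> t))\<^sup>2 = 1" by simp
  have "a * (cos (\<alpha> t))\<^sup>2 + a * (sin (\<alpha> t))\<^sup>2 = a" "b * (cos (\<alpha> t))\<^sup>2 + b * (sin (\<alpha> t))\<^sup>2 = b"
    using sc by algebra+
  then have e: "(a * cos (\<alpha> t) + b * sin (\<alpha> t)) * cos (\<alpha> t) - (b * cos (\<alpha> t) - a * sin (\<alpha> t)) * sin (\<alpha> t) = a"
    "(a * cos (\<alpha> t) + b * sin (\<alpha> t)) * sin (\<alpha> t) + (b * cos (\<alpha> t) - a * sin (\<alpha> t)) * cos (\<alpha> t) = b"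
    by (simp_all add: algebra_simps power2_eq_square)
  show "((\<lambda>s. \<eta> s * cos (\<alpha> s)) has_real_derivative \<eta> t * a / l) (at t)"
    by (rule DERIV_cong[OF DERIV_mult[OF assms(2) DERIV_fun_cos[OF assms(1)]]], subst (3) e(1)[symmetric])
      (simp add: algebra_simps diff_divide_distrib add_divide_distrib)
  show "((\<lambda>s. \<eta> s * sin (\<alpha> s)) has_real_derivative \<eta> t * b / l) (at t)"
    by (rule DERIV_cong[OF DERIV_mult[OF assms(2) DERIV_fun_sin[OF assms(1)]]], subst (3) e(2)[symmetric])
      (simp add: algebra_simps diff_divide_distrib add_divide_distrib)
qed

text \<open>
  Each component of the velocity \<open>V\<close> is a constant momentum plus multiples of components of the bar
  vectors \<open>\<eta>\<^sub>i (cos \<alpha>\<^sub>i, sin \<alpha>\<^sub>i)\<close>, so its derivative is a multiple of a component of \<open>V\<close>. In the derivative of \<open>bending\<close> those of the bar vectors drop out, since each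
  is parallel to \<open>V\<close> and \<open>bending\<close> pairs it with the normal of \<open>V\<close>; only the rotation of \<open>V\<close>
  contributes.
\<close>
lemma derivatives_along_H_flow:
  assumes Q: "(Q has_vector_derivative ham_vf (H l1 l2) (Q t)) (at t)"
  shows base_derivative: "((\<lambda>s. base (Q s)) has_vector_derivative velocity l1 l2 (Q t)) (at t)"
    and velocity_1_derivative: "((\<lambda>s. velocity l1 l2 (Q s) $ 1) has_real_derivative
          - (curvature l1 l2 (Q t) * velocity l1 l2 (Q t) $ 2)) (at t)"
    and velocity_2_derivative: "((\<lambda>s. velocity l1 l2 (Q s) $ 2) has_real_derivative
          curvature l1 l2 (Q t) * velocity l1 l2 (Q t) $ 1) (at t)"
    and curvature_derivative: "((\<lambda>s. curvature l1 l2 (Q s)) has_real_derivative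
          curvature_rate l1 l2 (Q t)) (at t)"
    and bending_derivative: "((\<lambda>s. bending l1 l2 (Q s)) has_real_derivative
          - (curvature l1 l2 (Q t) * curvature_rate l1 l2 (Q t))) (at t)"
proof -
  define X \<alpha> p \<eta> where "X s = fst (Q s)" and "\<alpha> s = fst (snd (Q s))"
    and "p s = fst (snd (snd (Q s)))" and "\<eta> s = snd (snd (snd (Q s)))" for s
  have Qs: "Q s = (X s, \<alpha> s, p s, \<eta> s)" for s by (simp add: X_def \<alpha>_def p_def \<eta>_def)
  define V where "V s = velocity l1 l2 (Q s)" for s
  have F: "ham_vf (H l1 l2) (Q t) = (V t,
     vector [(V t$2 * cos (\<alpha> t$1) - V t$1 * sin (\<alpha> t$1)) / l1,
             (V t$2 * cos (\<alpha> t$2) - V t$1 * sin (\<alpha> t$2)) / l2],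
     0,
     vector [\<eta> t$1 * (V t$1 * cos (\<alpha> t$1) + V t$2 * sin (\<alpha> t$1)) / l1,
             \<eta> t$2 * (V t$1 * cos (\<alpha> t$2) + V t$2 * sin (\<alpha> t$2)) / l2])"
    unfolding V_def Qs by (rule ham_vf_H)
  note fst = bounded_linear.has_vector_derivative[OF bounded_linear_fst]
  note snd = bounded_linear.has_vector_derivative[OF bounded_linear_snd]
  note nth = bounded_linear.has_vector_derivative[OF bounded_linear_vec_nth]
  show "((\<lambda>s. base (Q s)) has_vector_derivative velocity l1 l2 (Q t)) (at t)"
    using fst[OF Q] unfolding F base_def V_def by simp
  have "(\<alpha> has_vector_derivative fst (snd (ham_vf (H l1 l2) (Q t)))) (at t)"
    unfolding \<alpha>_def by (intro fst snd Q)
  from nth[OF this, of 1] nth[OF this, of 2]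
  have \<alpha>: "((\<lambda>s. \<alpha> s $ 1) has_real_derivative (V t$2 * cos (\<alpha> t$1) - V t$1 * sin (\<alpha> t$1)) / l1) (at t)"
    "((\<lambda>s. \<alpha> s $ 2) has_real_derivative (V t$2 * cos (\<alpha> t$2) - V t$1 * sin (\<alpha> t$2)) / l2) (at t)"
    by (simp_all add: F has_real_derivative_iff_has_vector_derivative)
  have "(p has_vector_derivative fst (snd (snd (ham_vf (H l1 l2) (Q t))))) (at t)"
    unfolding p_def by (intro fst snd Q)
  from nth[OF this, of 1] nth[OF this, of 2]
  have p: "((\<lambda>s. p s $ 1) has_real_derivative 0) (at t)" "((\<lambda>s. p s $ 2) has_real_derivative 0) (at t)"
    by (simp_all add: F has_real_derivative_iff_has_vector_derivative)
  have "(\<eta> has_vector_derivative snd (snd (snd (ham_vf (H l1 l2) (Q t))))) (at t)"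
    unfolding \<eta>_def by (intro snd Q)
  from nth[OF this, of 1] nth[OF this, of 2]
  have \<eta>: "((\<lambda>s. \<eta> s $ 1) has_real_derivative \<eta> t$1 * (V t$1 * cos (\<alpha> t$1) + V t$2 * sin (\<alpha> t$1)) / l1) (at t)"
    "((\<lambda>s. \<eta> s $ 2) has_real_derivative \<eta> t$2 * (V t$1 * cos (\<alpha> t$2) + V t$2 * sin (\<alpha> t$2)) / l2) (at t)"
    by (simp_all add: F has_real_derivative_iff_has_vector_derivative)
  note bar1 = bar_vector_derivative[OF \<alpha>(1) \<eta>(1)] and bar2 = bar_vector_derivative[OF \<alpha>(2) \<eta>(2)]
  have K: "curvature l1 l2 (Q s) = \<eta> s$1 / l1\<^sup>2 + \<eta> s$2 / l2\<^sup>2" for s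
    by (simp add: curvature_def Qs)
  have K': "curvature_rate l1 l2 (Q s) = (V s$1 * (\<eta> s$1 * cos (\<alpha> s$1)) + V s$2 * (\<eta> s$1 * sin (\<alpha> s$1))) / l1^3 +
     (V s$1 * (\<eta> s$2 * cos (\<alpha> s$2)) + V s$2 * (\<eta> s$2 * sin (\<alpha> s$2))) / l2^3" for s
    by (simp add: curvature_rate_def V_def Qs Let_def algebra_simps)
  have U: "bending l1 l2 (Q s) = (V s$1 * (\<eta> s$1 * sin (\<alpha> s$1)) - V s$2 * (\<eta> s$1 * cos (\<alpha> s$1))) / l1^3 +
     (V s$1 * (\<eta> s$2 * sin (\<alpha> s$2)) - V s$2 * (\<eta> s$2 * cos (\<alpha> s$2))) / l2^3" for s
    by (simp add: bending_def V_def Qs Let_def algebra_simps)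
  have "(\<lambda>s. V s $ 1) = (\<lambda>s. p s$1 - \<eta> s$1 * sin (\<alpha> s$1) / l1 - \<eta> s$2 * sin (\<alpha> s$2) / l2)"
    by (simp add: V_def velocity_def Qs)
  moreover have "(\<dots> has_real_derivative 0 - \<eta> t$1 * V t$2 / l1 / l1 - \<eta> t$2 * V t$2 / l2 / l2) (at t)"
    by (intro DERIV_diff DERIV_cdivide p bar1 bar2)
  ultimately have V1: "((\<lambda>s. V s $ 1) has_real_derivative - (curvature l1 l2 (Q t) * V t $ 2)) (at t)"
    by (simp add: K power2_eq_square algebra_simps)
  have "(\<lambda>s. V s $ 2) = (\<lambda>s. p s$2 + \<eta> s$1 * cos (\<alpha> s$1) / l1 + \<eta> s$2 * cos (\<alpha> s$2) / l2)"
    by (simp add: V_def velocity_def Qs)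
  moreover have "(\<dots> has_real_derivative 0 + \<eta> t$1 * V t$1 / l1 / l1 + \<eta> t$2 * V t$1 / l2 / l2) (at t)"
    by (intro DERIV_add DERIV_cdivide p bar1 bar2)
  ultimately have V2: "((\<lambda>s. V s $ 2) has_real_derivative curvature l1 l2 (Q t) * V t $ 1) (at t)"
    by (simp add: K power2_eq_square algebra_simps)
  show "((\<lambda>s. velocity l1 l2 (Q s) $ 1) has_real_derivative
          - (curvature l1 l2 (Q t) * velocity l1 l2 (Q t) $ 2)) (at t)"
    "((\<lambda>s. velocity l1 l2 (Q s) $ 2) has_real_derivative
          curvature l1 l2 (Q t) * velocity l1 l2 (Q t) $ 1) (at t)"
    using V1 V2 by (simp_all add: V_def)
  have "((\<lambda>s. \<eta> s$1 / l1\<^sup>2 + \<eta> s$2 / l2\<^sup>2) has_real_derivative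
     \<eta> t$1 * (V t$1 * cos (\<alpha> t$1) + V t$2 * sin (\<alpha> t$1)) / l1 / l1\<^sup>2 +
     \<eta> t$2 * (V t$1 * cos (\<alpha> t$2) + V t$2 * sin (\<alpha> t$2)) / l2 / l2\<^sup>2) (at t)"
    by (intro DERIV_add DERIV_cdivide \<eta>)
  then show "((\<lambda>s. curvature l1 l2 (Q s)) has_real_derivative
          curvature_rate l1 l2 (Q t)) (at t)"
    by (simp add: K K' power2_eq_square power3_eq_cube algebra_simps)
  let ?K = "curvature l1 l2 (Q t)"
  have "((\<lambda>s. (V s$1 * (\<eta> s$1 * sin (\<alpha> s$1)) - V s$2 * (\<eta> s$1 * cos (\<alpha> s$1))) / l1^3 +
     (V s$1 * (\<eta> s$2 * sin (\<alpha> s$2)) - V s$2 * (\<eta> s$2 * cos (\<alpha> s$2))) / l2^3) has_real_derivative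
     (- (?K * V t$2) * (\<eta> t$1 * sin (\<alpha> t$1)) + \<eta> t$1 * V t$2 / l1 * V t$1
       - (?K * V t$1 * (\<eta> t$1 * cos (\<alpha> t$1)) + \<eta> t$1 * V t$1 / l1 * V t$2)) / l1^3 +
     (- (?K * V t$2) * (\<eta> t$2 * sin (\<alpha> t$2)) + \<eta> t$2 * V t$2 / l2 * V t$1
       - (?K * V t$1 * (\<eta> t$2 * cos (\<alpha> t$2)) + \<eta> t$2 * V t$1 / l2 * V t$2)) / l2^3) (at t)"
    by (intro DERIV_add DERIV_diff DERIV_cdivide DERIV_mult bar1 bar2 V1 V2)
  moreover have "(- (?K * V t$2) * (\<eta> t$1 * sin (\<alpha> t$1)) + \<eta> t$1 * V t$2 / l1 * V t$1
       - (?K * V t$1 * (\<eta> t$1 * cos (\<alpha> t$1)) + \<eta> t$1 * V t$1 / l1 * V t$2)) / l1^3 +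
     (- (?K * V t$2) * (\<eta> t$2 * sin (\<alpha> t$2)) + \<eta> t$2 * V t$2 / l2 * V t$1
       - (?K * V t$1 * (\<eta> t$2 * cos (\<alpha> t$2)) + \<eta> t$2 * V t$1 / l2 * V t$2)) / l2^3
     = - (?K * curvature_rate l1 l2 (Q t))"
    unfolding K' by (simp add: algebra_simps add_divide_distrib diff_divide_distrib)
  ultimately show "((\<lambda>s. bending l1 l2 (Q s)) has_real_derivative
          - (?K * curvature_rate l1 l2 (Q t))) (at t)"
    unfolding U by simp
qed

text \<open>
  For \<open>H\<close> this holds because the velocity only turns; for \<open>G\<close> it follows from \<open>G_eq\<close>, where
  the derivative of \<open>bending\<close> cancels that of half the squared curvature.
\<close>
lemma conserved_along_H_flow:
  assumes I: "is_interval I" "s \<in> I" "t \<in> I"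
    and Q: "integral_curve (ham_vf (H l1 l2)) I Q"
  shows H_conserved: "H l1 l2 (Q t) = H l1 l2 (Q s)"
    and G_conserved: "G l1 l2 (Q t) = G l1 l2 (Q s)"
proof -
  have "convex I" using I(1) by (rule is_interval_convex)
  have D: "(Q has_vector_derivative ham_vf (H l1 l2) (Q r)) (at r)" if "r \<in> I" for r
    using Q that by (simp add: integral_curve_def)
  define V K where "V r = velocity l1 l2 (Q r)" and "K r = curvature l1 l2 (Q r)" for r
  define K' U where "K' r = curvature_rate l1 l2 (Q r)" and "U r = bending l1 l2 (Q r)" for r
  note flow = derivatives_along_H_flow[OF D, folded V_def K_def K'_def U_def]
  have H: "((\<lambda>r. H l1 l2 (Q r)) has_real_derivative 0) (at r)" if "r \<in> I" for r
  proof -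
    have "((\<lambda>r. (V r $ 1 * V r $ 1 + V r $ 2 * V r $ 2) / 2) has_real_derivative
        (- (K r * V r $ 2) * V r $ 1 + - (K r * V r $ 2) * V r $ 1
        + (K r * V r $ 1 * V r $ 2 + K r * V r $ 1 * V r $ 2)) / 2) (at r)"
      using that by (intro DERIV_cdivide DERIV_add DERIV_mult flow)
    then show ?thesis by (simp add: H_eq V_def power2_eq_square)
  qed
  have G: "((\<lambda>r. G l1 l2 (Q r)) has_real_derivative 0) (at r)" if "r \<in> I" for r
  proof -
    have "((\<lambda>r. (H l1 l2 (Q r) + 1/2) * (1 / l1\<^sup>2 + 1 / l2\<^sup>2) + U r + K r * K r / 2)
        has_real_derivative (0 + 0) * (1 / l1\<^sup>2 + 1 / l2\<^sup>2) + - (K r * K' r)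
          + (K' r * K r + K' r * K r) / 2) (at r)"
      using that by (intro DERIV_cdivide DERIV_cmult_right DERIV_add DERIV_mult DERIV_const flow H)
    then show ?thesis by (simp add: G_eq U_def K_def power2_eq_square)
  qed
  have const: "f t = f s" if "\<And>r. r \<in> I \<Longrightarrow> (f has_real_derivative 0) (at r)" for f :: "real \<Rightarrow> real"
    using has_field_derivative_zero_constant[OF \<open>convex I\<close>, of f] that I
    by (metis DERIV_subset subset_UNIV)
  show "H l1 l2 (Q t) = H l1 l2 (Q s)" "G l1 l2 (Q t) = G l1 l2 (Q s)"
    using const[of "\<lambda>r. H l1 l2 (Q r)"] const[of "\<lambda>r. G l1 l2 (Q r)"] H G by blast+
qed

section \<open>Angles of turning unit vectors in the plane\<close>

lemma antiderivative_open_interval: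
  fixes f :: "real \<Rightarrow> real"
  assumes "open I" "is_interval I" and f: "continuous_on I f"
  shows "\<exists>F. \<forall>t\<in>I. (F has_real_derivative f t) (at t)"
proof (cases "I = {}")
  case False
  \<comment> \<open>The end points may be infinite.\<close>
  define a b where "a = Inf (ereal ` I)" and "b = Sup (ereal ` I)"
  have I: "t \<in> I \<longleftrightarrow> a < ereal t \<and> ereal t < b" for t
  proof
    assume "t \<in> I"
    with \<open>open I\<close> obtain e where e: "e > 0" "cball t e \<subseteq> I"
      using open_contains_cball by blast
    then have "t - e \<in> I" "t + e \<in> I"
      by (auto simp: subset_iff dist_real_def)
    then have "a \<le> ereal (t - e)" "ereal (t + e) \<le> b"
      unfolding a_def b_def by (auto intro: Inf_lower Sup_upper)
    moreover have "ereal (t - e) < ereal t" "ereal t < ereal (t + e)" using e by simp_all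
    ultimately show "a < ereal t \<and> ereal t < b"
      by (meson le_less_trans less_le_trans)
  next
    assume "a < ereal t \<and> ereal t < b"
    then obtain r s where "r \<in> I" "s \<in> I" "r < t" "t < s"
      unfolding a_def b_def Inf_less_iff less_Sup_iff by auto
    with \<open>is_interval I\<close> show "t \<in> I"
      by (meson mem_is_interval_1_I less_imp_le)
  qed
  have "a < b" using False I by (metis ex_in_conv less_trans)
  moreover have "isCont f t" if "a < ereal t" "ereal t < b" for t
    using that f \<open>open I\<close> I continuous_on_eq_continuous_at by blast
  ultimately obtain F where "(F has_vector_derivative f t) (at t)" if "a < ereal t" "ereal t < b" for t
    using einterval_antiderivative[of a b f] by blast
  then show ?thesis
    unfolding has_real_derivative_iff_has_vector_derivative using I by blast
qed simp

text \<open>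
  An antiderivative \<open>\<gamma>\<close> of the turning rate, adjusted to be correct at one time, is correct
  throughout: the components of \<open>(a, b)\<close> in the frame turned by \<open>\<gamma>\<close> are constant.
\<close>
lemma angle_of_rotating_unit_vector:
  fixes a b k :: "real \<Rightarrow> real"
  assumes "open I" "is_interval I" "t\<^sub>0 \<in> I" "continuous_on I k"
    and unit: "(a t\<^sub>0)\<^sup>2 + (b t\<^sub>0)\<^sup>2 = 1"
    and a: "\<And>t. t \<in> I \<Longrightarrow> (a has_real_derivative - (k t * b t)) (at t)"
    and b: "\<And>t. t \<in> I \<Longrightarrow> (b has_real_derivative k t * a t) (at t)"
  shows "\<exists>\<gamma>. \<forall>t\<in>I. (\<gamma> has_real_derivative k t) (at t) \<and> cos (\<gamma> t) = a t \<and> sin (\<gamma> t) = b t"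
proof -
  obtain F where F: "\<And>t. t \<in> I \<Longrightarrow> (F has_real_derivative k t) (at t)"
    using antiderivative_open_interval[OF assms(1,2,4)] by blast
  obtain \<theta> where \<theta>: "a t\<^sub>0 = cos \<theta>" "b t\<^sub>0 = sin \<theta>"
    using sincos_total_2pi[OF unit] by metis
  define \<gamma> where "\<gamma> t = F t + (\<theta> - F t\<^sub>0)" for t
  have \<gamma>: "(\<gamma> has_real_derivative k t) (at t)" if "t \<in> I" for t
    unfolding \<gamma>_def using F[OF that] by (auto intro!: derivative_eq_intros)
  define c s where "c t = a t * cos (\<gamma> t) + b t * sin (\<gamma> t)"
    and "s t = b t * cos (\<gamma> t) - a t * sin (\<gamma> t)" for t
  have "convex I" using assms(2) by (rule is_interval_convex)
  have "(c has_real_derivative 0) (at t within I)" if "t \<in> I" for t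
  proof -
    have "(c has_real_derivative
        - (k t * b t) * cos (\<gamma> t) + - sin (\<gamma> t) * k t * a t
        + (k t * a t * sin (\<gamma> t) + cos (\<gamma> t) * k t * b t)) (at t)"
      unfolding c_def using that by (intro DERIV_add DERIV_mult DERIV_fun_cos DERIV_fun_sin a b \<gamma>)
    then show ?thesis by (simp add: algebra_simps has_field_derivative_at_within)
  qed
  from has_field_derivative_zero_constant[OF \<open>convex I\<close> this]
  obtain C where C: "\<And>t. t \<in> I \<Longrightarrow> c t = C" by blast
  moreover have "c t\<^sub>0 = 1" by (simp add: c_def \<gamma>_def \<theta> flip: power2_eq_square)
  ultimately have c: "c t = 1" if "t \<in> I" for t
    using that \<open>t\<^sub>0 \<in> I\<close> by metis
  have "(s has_real_derivative 0) (at t within I)" if "t \<in> I" for t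
  proof -
    have "(s has_real_derivative
        k t * a t * cos (\<gamma> t) + - sin (\<gamma> t) * k t * b t
        - (- (k t * b t) * sin (\<gamma> t) + cos (\<gamma> t) * k t * a t)) (at t)"
      unfolding s_def using that by (intro DERIV_diff DERIV_mult DERIV_fun_cos DERIV_fun_sin a b \<gamma>)
    then show ?thesis by (simp add: algebra_simps has_field_derivative_at_within)
  qed
  from has_field_derivative_zero_constant[OF \<open>convex I\<close> this]
  obtain S where S: "\<And>t. t \<in> I \<Longrightarrow> s t = S" by blast
  moreover have "s t\<^sub>0 = 0" by (simp add: s_def \<gamma>_def \<theta>)
  ultimately have s: "s t = 0" if "t \<in> I" for t
    using that \<open>t\<^sub>0 \<in> I\<close> by metis
  have "cos (\<gamma> t) = a t \<and> sin (\<gamma> t) = b t" if "t \<in> I" for t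
  proof -
    have "(cos (\<gamma> t))\<^sup>2 + (sin (\<gamma> t))\<^sup>2 = 1" by simp
    with c[OF that] s[OF that] show ?thesis unfolding c_def s_def by algebra
  qed
  with \<gamma> show ?thesis by blast
qed

text \<open>
  Differentiating \<open>cos \<gamma> = a\<close> alone determines the derivative of \<open>\<gamma>\<close> only where \<open>sin \<gamma>\<close> does not
  vanish, and conversely for the sine; both equations together suffice everywhere.
\<close>
lemma angle_derivative_unique:
  fixes \<gamma> a b :: "real \<Rightarrow> real"
  assumes "open I" "t \<in> I" and \<gamma>: "\<gamma> differentiable (at t)"
    and cs: "\<And>s. s \<in> I \<Longrightarrow> cos (\<gamma> s) = a s \<and> sin (\<gamma> s) = b s"
    and a: "(a has_real_derivative - (k * b t)) (at t)"
    and b: "(b has_real_derivative k * a t) (at t)"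
  shows "deriv \<gamma> t = k"
proof -
  have D: "(\<gamma> has_real_derivative deriv \<gamma> t) (at t)"
    using \<gamma> by (simp add: DERIV_deriv_iff_real_differentiable)
  have "(a has_real_derivative - sin (\<gamma> t) * deriv \<gamma> t) (at t)"
    using DERIV_fun_cos[OF D] \<open>t \<in> I\<close> cs
    by (auto intro: has_field_derivative_transform_within_open[OF _ \<open>open I\<close>])
  from DERIV_unique[OF this a] have 1: "sin (\<gamma> t) * deriv \<gamma> t = k * sin (\<gamma> t)"
    using cs \<open>t \<in> I\<close> by simp
  have "(b has_real_derivative cos (\<gamma> t) * deriv \<gamma> t) (at t)"
    using DERIV_fun_sin[OF D] \<open>t \<in> I\<close> cs
    by (auto intro: has_field_derivative_transform_within_open[OF _ \<open>open I\<close>])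
  from DERIV_unique[OF this b] have 2: "cos (\<gamma> t) * deriv \<gamma> t = k * cos (\<gamma> t)"
    using cs \<open>t \<in> I\<close> by simp
  have "(cos (\<gamma> t))\<^sup>2 + (sin (\<gamma> t))\<^sup>2 = 1" by simp
  with 1 2 show ?thesis by algebra
qed

lemma deriv_cong_on_open:
  fixes f g :: "real \<Rightarrow> real"
  assumes "(g has_real_derivative D) (at t)" "open I" "t \<in> I" "\<And>s. s \<in> I \<Longrightarrow> f s = g s"
  shows "f differentiable (at t) \<and> deriv f t = D"
proof -
  have "(f has_real_derivative D) (at t)"
    using has_field_derivative_transform_within_open[OF assms(1,2,3), of f] assms(4) by simp
  then show ?thesis
    using DERIV_imp_deriv real_differentiable_def by blast
qed

section \<open>The projected field along the curve\<close>

theorem theorem9: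
  fixes l1 l2 g :: real and I :: "real set"
    and Q\<^sub>0 :: phase and Q :: "real \<Rightarrow> phase"
    and x \<xi> :: "real \<Rightarrow> real^2"
  assumes "l1 > 0" and "l2 > 0" and "l1 \<noteq> l2"
    and "H l1 l2 Q\<^sub>0 = 1/2"
    and "g = G l1 l2 Q\<^sub>0"
    and "open I" and "is_interval I" and "0 \<in> I"
    and "integral_curve (ham_vf (H l1 l2)) I Q" and "Q 0 = Q\<^sub>0"
    and "x = (\<lambda>t. base (Q t))"
    and "\<xi> = (\<lambda>t. base (ham_vf (G l1 l2) (Q t)))"
  shows "(\<exists>\<gamma>. tangent_angle I x \<gamma>) \<and>
    (\<forall>\<gamma> \<kappa> u v.
       tangent_angle I x \<gamma> \<and>
       (\<forall>t\<in>I. \<kappa> t = deriv \<gamma> t) \<and>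
       (\<forall>t\<in>I. \<xi> t = u t *\<^sub>R tangent \<gamma> t + v t *\<^sub>R normal \<gamma> t) \<longrightarrow>
       (\<forall>t\<in>I. u t = g - (\<kappa> t)\<^sup>2 / 2 \<and> \<kappa> differentiable (at t) \<and> v t = - deriv \<kappa> t))"
proof -
  define V K where "V t = velocity l1 l2 (Q t)" and "K t = curvature l1 l2 (Q t)" for t
  have D: "(Q has_vector_derivative ham_vf (H l1 l2) (Q t)) (at t)" if "t \<in> I" for t
    using assms(9) that by (simp add: integral_curve_def)
  note flow = derivatives_along_H_flow[OF D, folded V_def K_def]
  have energy: "H l1 l2 (Q t) = 1/2" and G: "G l1 l2 (Q t) = g" if "t \<in> I" for t
    using H_conserved[OF assms(7,8) that assms(9)] G_conserved[OF assms(7,8) that assms(9)]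
      assms(4,5,10) by simp_all
  have x: "(x has_vector_derivative V t) (at t)" if "t \<in> I" for t
    using flow(1)[OF that] by (simp add: assms(11))
  have "continuous_on I K"
    using flow(4) by (meson DERIV_isCont continuous_at_imp_continuous_on)
  moreover have "(V 0 $ 1)\<^sup>2 + (V 0 $ 2)\<^sup>2 = 1"
    using energy[OF assms(8)] by (simp add: H_eq V_def)
  ultimately obtain \<gamma>\<^sub>0 where \<gamma>\<^sub>0: "\<And>t. t \<in> I \<Longrightarrow> (\<gamma>\<^sub>0 has_real_derivative K t) (at t) \<and>
      cos (\<gamma>\<^sub>0 t) = V t $ 1 \<and> sin (\<gamma>\<^sub>0 t) = V t $ 2"
    using angle_of_rotating_unit_vector[OF assms(6,7,8) _ _ flow(2,3)] by blast
  have "tangent \<gamma>\<^sub>0 t = V t" if "t \<in> I" for t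
    using \<gamma>\<^sub>0[OF that] by (simp add: tangent_def vec_eq_iff forall_2)
  then have "tangent_angle I x \<gamma>\<^sub>0"
    unfolding tangent_angle_def using \<gamma>\<^sub>0 x real_differentiable_def by metis
  moreover have "u t = g - (\<kappa> t)\<^sup>2 / 2 \<and> \<kappa> differentiable (at t) \<and> v t = - deriv \<kappa> t"
    if \<gamma>: "tangent_angle I x \<gamma>" and \<kappa>: "\<forall>t\<in>I. \<kappa> t = deriv \<gamma> t"
      and uv: "\<forall>t\<in>I. \<xi> t = u t *\<^sub>R tangent \<gamma> t + v t *\<^sub>R normal \<gamma> t" and t: "t \<in> I"
    for \<gamma> \<kappa> u v t
  proof -
    have T: "tangent \<gamma> s = V s" if "s \<in> I" for s
      using \<gamma> x[OF that] that by (meson tangent_angle_def vector_derivative_unique_at)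
    have cs: "cos (\<gamma> s) = V s $ 1 \<and> sin (\<gamma> s) = V s $ 2" if "s \<in> I" for s
      using T[OF that] by (simp add: tangent_def vec_eq_iff forall_2)
    have \<kappa>K: "\<kappa> s = K s" if "s \<in> I" for s
      using angle_derivative_unique[OF assms(6) that _ cs flow(2,3)[OF that]] \<gamma> \<kappa> that
      by (simp add: tangent_angle_def)
    \<comment> \<open>The function \<open>\<kappa>\<close> is only given on \<open>I\<close>, which is open, so its derivative at \<open>t\<close> is determined.\<close>
    have \<kappa>': "\<kappa> differentiable (at t) \<and> deriv \<kappa> t = curvature_rate l1 l2 (Q t)"
      using deriv_cong_on_open[OF flow(4)[OF t] assms(6) t \<kappa>K] .
    have N: "normal \<gamma> t = vector [- V t $ 2, V t $ 1]"
      using cs[OF t] by (simp add: normal_def)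
    have unit: "V t $ 1 * V t $ 1 + V t $ 2 * V t $ 2 = 1"
      using energy[OF t] by (simp add: H_eq V_def power2_eq_square)
    have \<xi>: "\<xi> t = u t *\<^sub>R V t + v t *\<^sub>R vector [- V t $ 2, V t $ 1]"
      using uv t T[OF t] N by simp
    have "\<xi> t \<bullet> V t = u t * (V t $ 1 * V t $ 1 + V t $ 2 * V t $ 2)"
      unfolding \<xi> by (simp add: inner_vec_def sum_2 algebra_simps)
    moreover have "\<xi> t \<bullet> V t = g - (\<kappa> t)\<^sup>2 / 2"
      using inner_G_field_velocity[of l1 l2 "Q t"] G_eq[of l1 l2 "Q t"] energy[OF t] G[OF t] \<kappa>K[OF t]
      by (simp add: assms(12) V_def K_def)
    moreover have "\<xi> t \<bullet> vector [- V t $ 2, V t $ 1] = v t * (V t $ 1 * V t $ 1 + V t $ 2 * V t $ 2)"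
      unfolding \<xi> by (simp add: inner_vec_def sum_2 algebra_simps)
    moreover have "\<xi> t \<bullet> vector [- V t $ 2, V t $ 1] = - deriv \<kappa> t"
      using inner_G_field_normal[of l1 l2 "Q t"] \<kappa>' by (simp add: assms(12) V_def)
    ultimately show ?thesis
      using \<kappa>' by (simp add: unit)
  qed
  ultimately show ?thesis by blast
qed

end
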